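(* Let $K\ge 1$ and $n\ge 0$ be integers, and let $A$ be an alphabet with $K$ letters. The number of recursively palindromic words of length $n$ over $A$ is exactly $K^{\alpha(n)}$, where $\alpha(n)$ denotes the sum of the binary digits of $n$.
   Context: For a word $w=a_1a_2\cdots a_m$, its left half is $w_L=a_1\cdots a_k$ and its right half is $w_R=a_{m-k+1}\cdots a_m$, where $k=\lfloor m/2\rfloor$ (so for $m=2k$ the halves are $a_1\cdots a_k$ and $a_{k+1}\cdots a_{2k}$, and for $m=2k+1$ they are $a_1\cdots a_k$ and $a_{k+2}\cdots a_{2k+1}$, omitting the middle letter). A word is recursively palindromic (RP) if it is empty, or it is a palindrome (equal to its reverse) and both its left half and its right half are recursively palindromic. For example, ABACABA is RP, while MADAM is not. *)

theory Defs
  imports Main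
begin

definition left_half :: "'a list \<Rightarrow> 'a list" where
  "left_half w = take (length w div 2) w"

definition right_half :: "'a list \<Rightarrow> 'a list" where
  "right_half w = drop (length w - length w div 2) w"

inductive rec_palindromic :: "'a list \<Rightarrow> bool" where
  empty: "rec_palindromic []"
| palindrome: "rev w = w \<Longrightarrow> rec_palindromic (left_half w) \<Longrightarrow> rec_palindromic (right_half w)
    \<Longrightarrow> rec_palindromic w"

text \<open>The positions \<open>i\<close> with \<open>2 ^ i \<le> n\<close> are those of the binary expansion of \<open>n\<close>
  without leading zeros; for \<open>n = 0\<close> there are none.\<close>

definition binary_digit_sum :: "nat \<Rightarrow> nat" where
  "binary_digit_sum n = (\<Sum>i | 2 ^ i \<le> n. n div 2 ^ i mod 2)"

lemma finite_binary_positions: "finite {i. 2 ^ i \<le> (n::nat)}"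
  by (rule finite_subset[of _ "{..n}"])
    (auto intro: order_trans[OF less_imp_le[OF less_exp]])

end

theory Submission
  imports Defs
begin

text \<open>The right half of a palindrome is the reverse of its left half. If the left half is itself a
  palindrome, the two halves coincide. So the recursively palindromic words of length \<open>n\<close> are exactly
  the words \<open>u @ m @ u\<close> with \<open>u\<close> recursively palindromic of length \<open>n div 2\<close> and \<open>m\<close> an arbitrary
  word of length \<open>n mod 2\<close>. Each binary digit 1 of \<open>n\<close> thus contributes one free letter.\<close>

lemma rec_palindromic_imp_palindrome: "rec_palindromic w \<Longrightarrow> rev w = w"
  by (erule rec_palindromic.cases) auto

lemma rec_palindromic_left_half: "rec_palindromic w \<Longrightarrow> rec_palindromic (left_half w)"
  by (erule rec_palindromic.cases) (auto simp: left_half_def intro: rec_palindromic.empty)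

lemma left_half_sandwich: "length m \<le> 1 \<Longrightarrow> left_half (u @ m @ u) = u"
  by (cases m) (auto simp: left_half_def)

lemma right_half_sandwich: "length m \<le> 1 \<Longrightarrow> right_half (u @ m @ u) = u"
  by (cases m) (auto simp: right_half_def)

text \<open>A word \<open>m\<close> of at most one letter is a palindrome and is exactly what the
  two halves leave out, so both halves are \<open>u\<close>.\<close>

lemma rec_palindromic_sandwich:
  assumes "length m \<le> 1"
  shows "rec_palindromic (u @ m @ u) \<longleftrightarrow> rec_palindromic u"
proof
  assume "rec_palindromic (u @ m @ u)"
  then show "rec_palindromic u"
    using rec_palindromic_left_half left_half_sandwich[OF assms] by metis
next
  assume u: "rec_palindromic u"
  have "rev m = m"
    using assms by (cases m) auto
  then have "rev (u @ m @ u) = u @ m @ u"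
    using rec_palindromic_imp_palindrome[OF u] by simp
  then show "rec_palindromic (u @ m @ u)"
    by (rule rec_palindromic.palindrome)
      (simp_all only: left_half_sandwich[OF assms] right_half_sandwich[OF assms] u)
qed

lemma rec_palindromic_decompose:
  assumes "rec_palindromic w"
  obtains u m where "w = u @ m @ u" "length u = length w div 2" "length m = length w mod 2"
proof -
  let ?k = "length w div 2" and ?l = "length w - length w div 2"
  have "drop ?l w = rev (take ?k w)"
    using rec_palindromic_imp_palindrome[OF assms] rev_take[of ?k w] by simp
  also have "\<dots> = take ?k w"
    using rec_palindromic_imp_palindrome[OF rec_palindromic_left_half[OF assms]]
    by (simp add: left_half_def)
  finally have right: "drop ?l w = take ?k w" .
  \<comment> \<open>The difference \<open>?l - ?k\<close> equals \<open>length w mod 2\<close>, so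
    the piece cut off here is the middle letter or empty.\<close>
  have "drop ?k w = take (?l - ?k) (drop ?k w) @ drop (?l - ?k) (drop ?k w)"
    by (rule append_take_drop_id[symmetric])
  also have "drop (?l - ?k) (drop ?k w) = drop ?l w"
    by simp
  finally have "w = take ?k w @ take (?l - ?k) (drop ?k w) @ take ?k w"
    using right append_take_drop_id[of ?k w] by metis
  then show thesis
    by (rule that) (simp, simp, presburger)
qed

text \<open>The middle words are restricted by \<open>set m \<subseteq> A\<close> instead of
  \<open>lists A\<close> to fit \<open>card_lists_length_eq\<close> in the later count.\<close>

lemma rec_palindromic_words_eq_image:
  "{w \<in> lists A. length w = n \<and> rec_palindromic w} =
    (\<lambda>(u, m). u @ m @ u) `
      ({u \<in> lists A. length u = n div 2 \<and> rec_palindromic u} \<times>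
       {m. set m \<subseteq> A \<and> length m = n mod 2})"
  (is "?L = ?f ` (?U \<times> ?M)")
proof (intro equalityI subsetI)
  fix w assume w: "w \<in> ?L"
  then obtain u m where um: "w = u @ m @ u" "length u = n div 2" "length m = n mod 2"
    using rec_palindromic_decompose[of w] by blast
  then have "length m \<le> 1"
    by simp
  then have "rec_palindromic u"
    using w um(1) rec_palindromic_sandwich by blast
  then have "(u, m) \<in> ?U \<times> ?M"
    using w um by auto
  then show "w \<in> ?f ` (?U \<times> ?M)"
    using um(1) by force
next
  fix w assume "w \<in> ?f ` (?U \<times> ?M)"
  then obtain u m where "w = u @ m @ u" "u \<in> ?U" "m \<in> ?M"
    by auto
  moreover from this have "length m \<le> 1"
    by simp
  moreover have "n div 2 + (n mod 2 + n div 2) = n"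
    by presburger
  ultimately show "w \<in> ?L"
    by (auto simp: rec_palindromic_sandwich)
qed

lemma card_rec_palindromic_words_step:
  assumes "finite A"
  shows "card {w \<in> lists A. length w = n \<and> rec_palindromic w} =
    card {w \<in> lists A. length w = n div 2 \<and> rec_palindromic w} * card A ^ (n mod 2)"
proof -
  \<comment> \<open>All \<open>u\<close> have the same length, so equal words have equal prefixes
    \<open>u\<close>; cancelling them leaves equal middles.\<close>
  have "inj_on (\<lambda>(u, m). u @ m @ u)
      ({u \<in> lists A. length u = n div 2 \<and> rec_palindromic u} \<times>
       {m. set m \<subseteq> A \<and> length m = n mod 2})"
    by (auto intro!: inj_onI)
  then show ?thesis
    by (simp add: rec_palindromic_words_eq_image[of A n] card_image card_cartesian_product
        card_lists_length_eq[OF assms])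
qed

lemma binary_digit_sum_0: "binary_digit_sum 0 = 0"
  by (simp add: binary_digit_sum_def)

text \<open>Halving drops the lowest digit \<open>n mod 2\<close> and moves every other digit down
  one position.\<close>

lemma binary_digit_sum_rec:
  assumes "n > 0"
  shows "binary_digit_sum n = n mod 2 + binary_digit_sum (n div 2)"
proof -
  \<comment> \<open>Position 0 is in the index set because \<open>n > 0\<close>; position
    \<open>Suc j\<close> for \<open>n\<close> is position \<open>j\<close> for
    \<open>n div 2\<close>.\<close>
  have "2 ^ i \<le> n \<longleftrightarrow> i = 0 \<or> (\<exists>j. i = Suc j \<and> 2 ^ j \<le> n div 2)" for i
    using assms by (cases i) (auto simp: less_eq_div_iff_mult_less_eq mult.commute)
  then have positions: "{i. 2 ^ i \<le> n} = insert 0 (Suc ` {j. 2 ^ j \<le> n div 2})"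
    by auto
  show ?thesis
    by (simp add: binary_digit_sum_def positions finite_binary_positions sum.reindex
        div_mult2_eq)
qed

theorem theorem1:
  fixes A :: "'a set" and K n :: nat
  assumes "K \<ge> 1" and "finite A" and "card A = K"
  shows "card {w \<in> lists A. length w = n \<and> rec_palindromic w} = K ^ binary_digit_sum n"
proof (induction n rule: less_induct)
  case (less n)
  show ?case
  \<comment> \<open>Halving decreases only positive lengths, so length 0 is counted
    directly.\<close>
  proof (cases "n = 0")
    case True
    have "{w \<in> lists A. length w = 0 \<and> rec_palindromic w} = {[]}"
      by (auto intro: rec_palindromic.empty)
    then show ?thesis
      using True by (simp add: binary_digit_sum_0)
  next
    case False
    then have "card {w \<in> lists A. length w = n div 2 \<and> rec_palindromic w}
        = K ^ binary_digit_sum (n div 2)"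
      by (intro less.IH) simp
    then show ?thesis
      using False assms(3)
      by (simp add: card_rec_palindromic_words_step[OF assms(2), of n] binary_digit_sum_rec
          power_add mult.commute)
  qed
qed

end
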